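(* Let $(\mathcal X,d)$ be a compact metric space, let $C:\mathcal X\times\mathcal X\to\mathbb R$ be a symmetric, $L$-Lipschitz cost function, and let $\alpha,\beta\in\mathcal P(\mathcal X)$. Let $(n_t)_t$ be the total numbers of observed samples and let $(\eta_t)_t$ be step sizes in $[0,1]$ such that, for some constant $B>0$ and positive sequence $(w_t)_t$: for all $t>0$, the total batch size $n_t=\frac{B}{w_t^2}$ is an integer; $\sum_t w_t\eta_t<\infty$; and $\sum_t\eta_t=\infty$. Then the iterates $(\hat f_t,\hat g_t)_t$ of the fully-corrective online Sinkhorn algorithm converge almost surely: $$\|\hat f_t-f^\star\|_{\mathrm{var}}+\|\hat g_t-g^\star\|_{\mathrm{var}}\longrightarrow0\quad\text{as }t\to\infty.$$
   Context: $\mathcal C(\mathcal X)$ is the set of continuous real functions on $\mathcal X$, $\mathcal P(\mathcal X)$ the set of Borel probability measures on $\mathcal X$. For $h\in\mathcal C(\mathcal X)$ and $\mu\in\mathcal P(\mathcal X)$ the soft $C$-transform is $T_\mu(h)(\cdot)=-\log\int_{\mathcal X}\exp(h(y)-C(\cdot,y))\,d\mu(y)$ (the regularization parameter is $\varepsilon=1$). The variation norm is $\|f\|_{\mathrm{var}}=\max_x f(x)-\min_x f(x)$ (functions are considered up to additive constants). Optimal potentials: $(f^\star,g^\star)\in\mathcal C(\mathcal X)^2$ is a solution of the dual entropic optimal transport problem $\max_{f,g\in\mathcal C(\mathcal X)}\int f\,d\alpha+\int g\,d\beta-\int\!\!\int e^{f(x)+g(y)-C(x,y)}d\alpha(x)d\beta(y)+1$,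 satisfying $f^\star=T_\beta(g^\star)$ and $g^\star=T_\alpha(f^\star)$ on all of $\mathcal X$; it is unique up to $(f^\star+c,g^\star-c)$, $c\in\mathbb R$. Fully-corrective online Sinkhorn algorithm: let $(x_i)_i$ be i.i.d. from $\alpha$ and $(y_i)_i$ i.i.d. from $\beta$, all independent. At iteration $t$ a batch of $n(t)\ge1$ new samples from each distribution is drawn, $n_0=0$, $n_{t+1}=n_t+n(t)$. Let $\bar\alpha_t=\frac1{n_t}\sum_{i=1}^{n_t}\delta_{x_i}$ and $\bar\beta_t=\frac1{n_t}\sum_{i=1}^{n_t}\delta_{y_i}$ be the empirical measures of all samples seen so far. Initialize from the first batch with zero weights: $e^{-\hat f_1(\cdot)}=\sum_{i=1}^{n_1}e^{-C(\cdot,y_i)}$, $e^{-\hat g_1(\cdot)}=\sum_{i=1}^{n_1}e^{-C(x_i,\cdot)}$. For $t\ge1$, $$\hat f_{t+1}=T_{\bar\beta_{t+1}}(\hat g_t),\qquad\hat g_{t+1}=T_{\bar\alpha_{t+1}}(\hat f_t).$$ The step sizes $\eta_t$ do not enter these updates; they only enter through the assumption on $(n_t)_t$. *)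

theory Defs
  imports "HOL-Probability.Probability"
begin

definition soft_transform :: "('a::topological_space \<Rightarrow> 'a \<Rightarrow> real) \<Rightarrow> 'a measure \<Rightarrow> ('a \<Rightarrow> real) \<Rightarrow> 'a \<Rightarrow> real"
  where "soft_transform C \<mu> h u = - ln (\<integral>v. exp (h v - C u v) \<partial>\<mu>)"

text \<open>On a compact space the supremum and infimum below are attained whenever the function is
  continuous, so they are the maximum and the minimum.\<close>

definition var_norm :: "('a::topological_space \<Rightarrow> real) \<Rightarrow> real"
  where "var_norm f = (SUP u. f u) - (INF u. f u)"

definition dual_objective ::
    "('a::topological_space \<Rightarrow> 'a \<Rightarrow> real) \<Rightarrow> 'a measure \<Rightarrow> 'a measure \<Rightarrow> ('a \<Rightarrow> real) \<Rightarrow> ('a \<Rightarrow> real) \<Rightarrow> real"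
  where "dual_objective C \<alpha> \<beta> f g =
    (\<integral>u. f u \<partial>\<alpha>) + (\<integral>v. g v \<partial>\<beta>) - (\<integral>u. (\<integral>v. exp (f u + g v - C u v) \<partial>\<beta>) \<partial>\<alpha>) + 1"

text \<open>Dual maximality determines the potentials only almost everywhere; the two fixed-point
  equations, required at every point, select the representatives.\<close>

definition optimal_potentials ::
    "('a::topological_space \<Rightarrow> 'a \<Rightarrow> real) \<Rightarrow> 'a measure \<Rightarrow> 'a measure \<Rightarrow> ('a \<Rightarrow> real) \<Rightarrow> ('a \<Rightarrow> real) \<Rightarrow> bool"
  where "optimal_potentials C \<alpha> \<beta> f g \<longleftrightarrow>
    continuous_on UNIV f \<and> continuous_on UNIV g \<and>
    (\<forall>f' g'. continuous_on UNIV f' \<longrightarrow> continuous_on UNIV g' \<longrightarrow>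
       dual_objective C \<alpha> \<beta> f' g' \<le> dual_objective C \<alpha> \<beta> f g) \<and>
    f = soft_transform C \<beta> g \<and> g = soft_transform C \<alpha> f"

text \<open>The push-forward of the uniform distribution on the index set, i.e. the average of the
  Dirac measures at \<open>z 0, \<dots>, z (m - 1)\<close> (see \<open>emeasure_empirical_measure\<close>).\<close>

definition empirical_measure :: "nat \<Rightarrow> (nat \<Rightarrow> 'a::topological_space) \<Rightarrow> 'a measure"
  where "empirical_measure m z = distr (uniform_count_measure {..<m}) borel z"

lemma emeasure_empirical_measure:
  assumes "m > 0" and A: "A \<in> sets borel"
  shows "emeasure (empirical_measure m z) A
    = ennreal (1 / real m) * (\<Sum>i<m. emeasure (return borel (z i)) A)"
proof -
  have "emeasure (empirical_measure m z) A
      = emeasure (uniform_count_measure {..<m}) (z -` A \<inter> {..<m})"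
    unfolding empirical_measure_def using A
    by (subst emeasure_distr) (auto simp: space_uniform_count_measure sets_uniform_count_measure measurable_def)
  also have "\<dots> = ennreal (1 / real m) * ennreal (real (card (z -` A \<inter> {..<m})))"
    using assms(1) by (subst emeasure_uniform_count_measure) (auto simp: ennreal_mult[symmetric])
  also have "real (card (z -` A \<inter> {..<m})) = (\<Sum>i<m. indicator A (z i))"
    by (simp add: indicator_def sum.If_cases Int_commute vimage_def)
  also have "ennreal (\<Sum>i<m. indicator A (z i)) = (\<Sum>i<m. emeasure (return borel (z i)) A)"
    using A by (simp add: sum_ennreal[symmetric] ennreal_indicator)
  finally show ?thesis .
qed

text \<open>\<open>n t\<close> is the total number of samples seen at iteration \<open>t\<close>; samples are numbered from \<open>0\<close>,
  iterations from \<open>1\<close>, and the values \<open>f 0\<close>, \<open>g 0\<close> are irrelevant.\<close>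

definition fully_corrective_sinkhorn ::
    "('a::topological_space \<Rightarrow> 'a \<Rightarrow> real) \<Rightarrow> (nat \<Rightarrow> nat) \<Rightarrow> (nat \<Rightarrow> 'a) \<Rightarrow> (nat \<Rightarrow> 'a) \<Rightarrow>
     (nat \<Rightarrow> 'a \<Rightarrow> real) \<Rightarrow> (nat \<Rightarrow> 'a \<Rightarrow> real) \<Rightarrow> bool"
  where "fully_corrective_sinkhorn C n x y f g \<longleftrightarrow>
    (\<forall>u. exp (- f 1 u) = (\<Sum>i<n 1. exp (- C u (y i)))) \<and>
    (\<forall>v. exp (- g 1 v) = (\<Sum>i<n 1. exp (- C (x i) v))) \<and>
    (\<forall>t\<ge>1. f (t + 1) = soft_transform C (empirical_measure (n (t + 1)) y) (g t) \<and>
            g (t + 1) = soft_transform C (empirical_measure (n (t + 1)) x) (f t))"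

end

theory Submission
  imports Defs
begin

text \<open>
  Two facts carry the proof. Every soft transform \<open>T\<^sub>\<mu>\<close>, whatever the probability measure \<open>\<mu>\<close>, is a
  contraction of the variation norm, with a factor \<open>\<kappa> = 1 - exp (- 2 * L * diameter UNIV) < 1\<close> that
  depends on the cost alone (\<open>var_norm_soft_transform_diff_le\<close>). And for a single fixed potential \<open>h\<close>
  the transform with respect to the empirical measure of the first \<open>m\<close> samples converges to the
  transform with respect to the law of the samples, almost surely and uniformly on the space
  (\<open>AE_uniform_limit_soft_transform_empirical\<close>).

  Because \<open>\<kappa>\<close> is the same for all measures, it applies to the random, changing empirical measures
  of the algorithm. Comparing an iterate with the optimal potentials through
  \<open>T\<^bsub>emp\<^esub> (ghat t) - fstar = (T\<^bsub>emp\<^esub> (ghat t) - T\<^bsub>emp\<^esub> gstar) + (T\<^bsub>emp\<^esub> gstar - T\<^sub>\<beta> gstar)\<close>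
  and similarly for the other potential, the total error \<open>e\<close> satisfies
  \<open>e (t + 1) \<le> \<kappa> * e t + \<delta> t\<close>, where \<open>\<delta> t\<close> involves only the fixed potentials and hence tends to
  \<open>0\<close> almost surely as soon as the sample size tends to infinity. Such a recursion forces
  \<open>e t \<longlonglongrightarrow> 0\<close> (\<open>contraction_with_vanishing_error_tendsto_0\<close>). The sample size does tend to infinity
  since every batch is nonempty.
\<close>

section \<open>The variation norm\<close>

lemma var_norm_le:
  fixes f :: "'a::topological_space \<Rightarrow> real"
  assumes "\<And>u v. f u - f v \<le> d"
  shows "var_norm f \<le> d"
proof -
  have "Sup (range f) \<le> d + f v" for v
    using assms by (intro cSup_least) (auto simp: algebra_simps)
  then have "Sup (range f) - d \<le> Inf (range f)"
    by (intro cInf_greatest) (auto simp: algebra_simps)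
  then show ?thesis unfolding var_norm_def by linarith
qed

lemma diff_le_var_norm:
  fixes f :: "'a::topological_space \<Rightarrow> real"
  assumes "bounded (range f)"
  shows "f u - f v \<le> var_norm f"
proof -
  have "f u \<le> Sup (range f)"
    using assms by (intro cSup_upper) (auto intro: bounded_imp_bdd_above)
  moreover have "Inf (range f) \<le> f v"
    using assms by (intro cInf_lower) (auto intro: bounded_imp_bdd_below)
  ultimately show ?thesis unfolding var_norm_def by linarith
qed

lemma var_norm_nonneg:
  fixes f :: "'a::topological_space \<Rightarrow> real"
  assumes "bounded (range f)"
  shows "0 \<le> var_norm f"
  using diff_le_var_norm[OF assms, of undefined undefined] by simp

lemma var_norm_add_le:
  fixes f g :: "'a::topological_space \<Rightarrow> real"
  assumes "bounded (range f)" "bounded (range g)"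
  shows "var_norm (\<lambda>u. f u + g u) \<le> var_norm f + var_norm g"
proof (rule var_norm_le)
  fix u v
  show "f u + g u - (f v + g v) \<le> var_norm f + var_norm g"
    using diff_le_var_norm[OF assms(1), of u v] diff_le_var_norm[OF assms(2), of u v] by linarith
qed

lemma uniform_limit_imp_var_norm_tendsto_0:
  fixes F :: "nat \<Rightarrow> 'a::topological_space \<Rightarrow> real"
  assumes "uniform_limit UNIV F f sequentially"
    and bounded: "\<forall>\<^sub>F m in sequentially. bounded (range (\<lambda>u. F m u - f u))"
  shows "(\<lambda>m. var_norm (\<lambda>u. F m u - f u)) \<longlonglongrightarrow> 0"
proof (rule tendstoI)
  fix r :: real assume r: "r > 0"
  have "\<forall>\<^sub>F m in sequentially. \<forall>u\<in>UNIV. dist (F m u) (f u) < r / 4"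
    using r by (intro uniform_limitD[OF assms(1)]) simp
  with bounded show "\<forall>\<^sub>F m in sequentially. dist (var_norm (\<lambda>u. F m u - f u)) 0 < r"
  proof eventually_elim
    case (elim m)
    have "var_norm (\<lambda>u. F m u - f u) \<le> r / 2"
    proof (rule var_norm_le)
      fix u v
      have "dist (F m u) (f u) < r / 4" "dist (F m v) (f v) < r / 4"
        using elim by auto
      then show "F m u - f u - (F m v - f v) \<le> r / 2"
        unfolding dist_real_def by linarith
    qed
    then show ?case using var_norm_nonneg[OF elim(1)] r by simp
  qed
qed

section \<open>Perturbed contractions\<close>

text \<open>Unrolling the recursion from an index after which every error is at most
  \<open>(1 - \<kappa>) * r / 2\<close> leaves \<open>\<kappa> ^ k * e N\<close> plus a geometric sum of at most \<open>r / 2\<close>.\<close>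

lemma contraction_with_vanishing_error_tendsto_0:
  fixes e \<delta> :: "nat \<Rightarrow> real"
  assumes \<kappa>: "0 \<le> \<kappa>" "\<kappa> < 1"
    and nonneg: "\<And>t. t \<ge> 1 \<Longrightarrow> 0 \<le> e t"
    and step: "\<And>t. t \<ge> 1 \<Longrightarrow> e (t + 1) \<le> \<kappa> * e t + \<delta> t"
    and \<delta>: "\<delta> \<longlonglongrightarrow> 0"
  shows "e \<longlonglongrightarrow> 0"
proof (rule tendstoI)
  fix r :: real assume r: "r > 0"
  then have "(1 - \<kappa>) * r / 2 > 0" using \<kappa> by simp
  from order_tendstoD(2)[OF \<delta> this]
  obtain N0 where N0: "\<And>t. t \<ge> N0 \<Longrightarrow> \<delta> t < (1 - \<kappa>) * r / 2"
    by (auto simp: eventually_sequentially)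
  define N where "N = max N0 1"
  have bound: "e (N + k) \<le> \<kappa> ^ k * e N + r / 2" for k
  proof (induction k)
    case 0
    then show ?case using r by simp
  next
    case (Suc k)
    have "e (N + k + 1) \<le> \<kappa> * e (N + k) + \<delta> (N + k)"
      by (rule step) (simp add: N_def)
    also have "\<dots> \<le> \<kappa> * (\<kappa> ^ k * e N + r / 2) + (1 - \<kappa>) * r / 2"
      using Suc.IH \<kappa>(1) less_imp_le[OF N0[of "N + k"]]
      by (intro add_mono mult_left_mono) (simp_all add: N_def)
    finally show ?case by (simp add: field_simps)
  qed
  have "(\<lambda>k. \<kappa> ^ k * e N) \<longlonglongrightarrow> 0"
    using \<kappa> by (intro tendsto_mult_left_zero LIMSEQ_realpow_zero) auto
  then have "\<forall>\<^sub>F k in sequentially. \<kappa> ^ k * e N < r / 2"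
    using r by (intro order_tendstoD) auto
  then obtain K where K: "\<And>k. k \<ge> K \<Longrightarrow> \<kappa> ^ k * e N < r / 2"
    by (auto simp: eventually_sequentially)
  have "dist (e t) 0 < r" if t: "t \<ge> N + K" for t
  proof -
    have "K \<le> t - N" "N + (t - N) = t" using t by simp_all
    then have "e t < r" using bound[of "t - N"] K[of "t - N"] by simp
    moreover have "0 \<le> e t" using t by (intro nonneg) (simp add: N_def)
    ultimately show ?thesis by simp
  qed
  then show "\<forall>\<^sub>F t in sequentially. dist (e t) 0 < r"
    by (auto simp: eventually_sequentially)
qed

section \<open>A strong law of large numbers for bounded variables\<close>

lemma (in prob_space) indep_vars_reindex:
  assumes indep: "indep_vars (\<lambda>_. N) X UNIV" and f: "inj f"
  shows "indep_vars (\<lambda>_. N) (\<lambda>i. X (f i)) UNIV"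
  unfolding indep_vars_def2
proof (intro conjI ballI indep_setsI)
  have *: "indep_sets (\<lambda>i. {X i -` A \<inter> space M |A. A \<in> sets N}) UNIV"
    and rv: "\<And>i. random_variable N (X i)"
    using indep by (auto simp: indep_vars_def2)
  show "random_variable N (X (f i))" for i by (rule rv)
  show "{X (f i) -` A \<inter> space M |A. A \<in> sets N} \<subseteq> events" for i
    using rv by (auto intro: measurable_sets)
  fix A J assume J: "J \<noteq> {}" "finite J"
    and A: "\<forall>j\<in>J. A j \<in> {X (f j) -` A \<inter> space M |A. A \<in> sets N}"
  have "prob (\<Inter>k\<in>f ` J. A (inv f k)) = (\<Prod>k\<in>f ` J. prob (A (inv f k)))"
    using J A f by (intro indep_setsD[OF *]) (auto simp: inv_f_f)
  then show "prob (\<Inter>j\<in>J. A j) = (\<Prod>j\<in>J. prob (A j))"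
    using f by (simp add: prod.reindex inj_on_subset[OF f] inv_f_f)
qed

text \<open>For bounded variables Hoeffding's inequality makes the probability of a deviation of size \<open>r\<close>
  of the \<open>m\<close>-th average decay geometrically in \<open>m\<close>, so the Borel-Cantelli lemma applies to each
  \<open>r\<close> directly; the radii \<open>1 / (k + 1)\<close> then suffice.\<close>

lemma (in prob_space) strong_law_of_large_numbers_bounded:
  fixes X :: "nat \<Rightarrow> 'a \<Rightarrow> real"
  assumes indep: "indep_vars (\<lambda>_. borel) X UNIV"
    and distr: "\<And>i. distr M borel (X i) = distr M borel (X 0)"
    and bound: "\<And>i \<omega>. \<omega> \<in> space M \<Longrightarrow> \<bar>X i \<omega>\<bar> \<le> K"
  shows "AE \<omega> in M. (\<lambda>m. (\<Sum>i<m. X i \<omega>) / real m) \<longlonglongrightarrow> expectation (X 0)"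
proof -
  define b where "b = \<bar>K\<bar> + 1"
  have b: "b > 0" unfolding b_def by simp
  have rv [measurable]: "random_variable borel (X i)" for i
    using indep by (auto simp: indep_vars_def2)
  define A where "A r m = {\<omega> \<in> space M. r \<le> \<bar>(\<Sum>i<m. X i \<omega>) / real m - expectation (X 0)\<bar>}" for r m
  have A_sets [measurable]: "A r m \<in> sets M" for r m
    unfolding A_def by measurable
  have dev: "AE \<omega> in M. \<forall>\<^sub>F m in sequentially. \<omega> \<in> space M - A r m" if r: "r > 0" for r
  proof (rule borel_cantelli_AE1)
    define q where "q = exp (- (2 * r\<^sup>2 / (b - (- b))\<^sup>2))"
    have q: "0 \<le> q" "q < 1" using r b by (auto simp: q_def)
    have "prob (A r m) \<le> 2 * q ^ m" if m: "m \<ge> 1" for m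
    proof -
      interpret Hoeffding_ineq_iid M "{..<m}" X "X 0" "- b" b "expectation (X 0)"
      proof unfold_locales
        show "indep_vars (\<lambda>_. borel) X {..<m}"
          by (rule indep_vars_subset[OF indep]) simp
        show "AE \<omega> in M. X 0 \<omega> \<in> {- b..b}"
        proof (rule AE_I2)
          fix \<omega> assume "\<omega> \<in> space M"
          from bound[OF this, of 0] show "X 0 \<omega> \<in> {- b..b}" by (auto simp: b_def)
        qed
        show "distr M borel (X i) = distr M borel (X 0)" for i by (rule distr)
      qed (rule finite_lessThan rv)+
      have nonempty: "{..<m} \<noteq> {}" using m by (auto simp: lessThan_empty_iff)
      have "- b < b" using b by simp
      from Hoeffding_ineq_abs_ge'[OF less_imp_le[OF r] this nonempty]
      have "prob (A r m) \<le> 2 * exp (- 2 * real m * r\<^sup>2 / (b - (- b))\<^sup>2)"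
        unfolding A_def card_lessThan .
      also have "exp (- 2 * real m * r\<^sup>2 / (b - (- b))\<^sup>2) = q ^ m"
        unfolding q_def exp_of_nat_mult[symmetric] by (simp add: field_simps)
      finally show ?thesis .
    qed
    then have "norm (prob (A r m)) \<le> 2 * q ^ m" if "m \<ge> 1" for m
      using that by simp
    moreover have "summable (\<lambda>m. 2 * q ^ m)"
      using q by (intro summable_mult summable_geometric) simp
    ultimately show "summable (\<lambda>m. prob (A r m))"
      by (rule summable_comparison_test'[rotated])
  qed (auto simp: emeasure_eq_measure)
  have "AE \<omega> in M. \<forall>k. \<forall>\<^sub>F m in sequentially. \<omega> \<in> space M - A (inverse (real (Suc k))) m"
    unfolding AE_all_countable by (intro allI dev) simp
  then show ?thesis
  proof eventually_elim
    case (elim \<omega>)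
    show ?case
    proof (rule tendstoI)
      fix r :: real assume "r > 0"
      then obtain k where k: "inverse (real (Suc k)) < r" using reals_Archimedean by blast
      from elim[rule_format, of k]
      show "\<forall>\<^sub>F m in sequentially. dist ((\<Sum>i<m. X i \<omega>) / real m) (expectation (X 0)) < r"
        by eventually_elim (use k in \<open>auto simp: A_def dist_real_def\<close>)
    qed
  qed
qed

section \<open>Empirical measures and equi-Lipschitz functions\<close>

lemma measurable_from_uniform_count_measure:
  "z \<in> measurable (uniform_count_measure A) N \<longleftrightarrow> z \<in> A \<rightarrow> space N"
  by (auto simp: measurable_def space_uniform_count_measure sets_uniform_count_measure)

lemma sets_empirical_measure: "sets (empirical_measure m z) = sets borel"
  by (simp add: empirical_measure_def)

lemma prob_space_empirical_measure:
  assumes "m > 0"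
  shows "prob_space (empirical_measure m z)"
  unfolding empirical_measure_def using assms
  by (intro prob_space.prob_space_distr prob_space_uniform_count_measure)
    (auto simp: measurable_from_uniform_count_measure lessThan_empty_iff)

lemma integral_empirical_measure:
  fixes h :: "'a::topological_space \<Rightarrow> real"
  assumes "h \<in> borel_measurable borel"
  shows "(\<integral>v. h v \<partial>empirical_measure m z) = (\<Sum>i<m. h (z i)) / real m"
  unfolding empirical_measure_def using assms
  by (subst integral_distr)
    (auto simp: measurable_from_uniform_count_measure integral_uniform_count_measure)

lemma compact_obtain_countable_nets:
  assumes "compact (S :: 'a::metric_space set)"
  obtains D where "countable D"
    "\<And>e. e > 0 \<Longrightarrow> \<exists>K\<subseteq>D. finite K \<and> S \<subseteq> (\<Union>x\<in>K. ball x e)"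
proof -
  have "\<forall>e>0. \<exists>K. finite K \<and> S \<subseteq> (\<Union>x\<in>K. ball x e)"
    using assms by (simp add: compact_eq_totally_bounded)
  then have "\<exists>K. finite K \<and> S \<subseteq> (\<Union>x\<in>K. ball x (inverse (real (Suc j))))" for j
    by (metis inverse_positive_iff_positive of_nat_0_less_iff zero_less_Suc)
  then obtain N where N: "\<And>j. finite (N j)"
    "\<And>j. S \<subseteq> (\<Union>x\<in>N j. ball x (inverse (real (Suc j))))" by metis
  show ?thesis
  proof
    show "countable (\<Union>j. N j)" using N(1) by (auto intro: countable_finite)
    fix e :: real assume "e > 0"
    then obtain j where "inverse (real (Suc j)) < e" using reals_Archimedean by blast
    then have "(\<Union>x\<in>N j. ball x (inverse (real (Suc j)))) \<subseteq> (\<Union>x\<in>N j. ball x e)"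
      by (intro UN_mono subset_ball) auto
    then have "S \<subseteq> (\<Union>x\<in>N j. ball x e)" using N(2)[of j] by (rule subset_trans[rotated])
    then show "\<exists>K\<subseteq>(\<Union>j. N j). finite K \<and> S \<subseteq> (\<Union>x\<in>K. ball x e)"
      using N(1)[of j] by (intro exI[of _ "N j"]) auto
  qed
qed

text \<open>A common Lipschitz constant transports convergence at the finitely many points of a net to
  the whole space; this is the step that turns a countable family of almost sure statements into a
  uniform one.\<close>

lemma equi_lipschitz_uniform_limit:
  fixes F :: "nat \<Rightarrow> 'a::metric_space \<Rightarrow> real"
  assumes L: "0 \<le> L"
    and F: "\<forall>\<^sub>F m in sequentially. \<forall>u v. \<bar>F m u - F m v\<bar> \<le> L * dist u v"
    and f: "\<And>u v. \<bar>f u - f v\<bar> \<le> L * dist u v"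
    and nets: "\<And>e. e > 0 \<Longrightarrow> \<exists>K\<subseteq>D. finite K \<and> UNIV \<subseteq> (\<Union>x\<in>K. ball x e)"
    and conv: "\<And>x. x \<in> D \<Longrightarrow> (\<lambda>m. F m x) \<longlonglongrightarrow> f x"
  shows "uniform_limit UNIV F f sequentially"
proof (rule uniform_limitI)
  fix r :: real assume r: "r > 0"
  define e where "e = r / (3 * (L + 1))"
  have e: "e > 0" using r L by (simp add: e_def)
  have "L * e \<le> (L + 1) * e" using e by simp
  also have "\<dots> = r / 3" using L by (simp add: e_def field_simps)
  finally have Le: "L * e \<le> r / 3" .
  obtain K where K: "K \<subseteq> D" "finite K" "UNIV \<subseteq> (\<Union>x\<in>K. ball x e)"
    using nets[OF e] by blast
  have "\<forall>\<^sub>F m in sequentially. \<forall>x\<in>K. dist (F m x) (f x) < r / 3"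
    using K(1,2) r by (intro eventually_ball_finite ballI tendstoD conv) auto
  with F show "\<forall>\<^sub>F m in sequentially. \<forall>u\<in>UNIV. dist (F m u) (f u) < r"
  proof eventually_elim
    case (elim m)
    show ?case
    proof
      fix u
      have "u \<in> (\<Union>x\<in>K. ball x e)" using K(3) by blast
      then obtain x where x: "x \<in> K" "dist x u < e" by auto
      have "L * dist x u \<le> L * e" using x L by (intro mult_left_mono) auto
      then have "L * dist x u \<le> r / 3" using Le by simp
      moreover have "\<bar>F m x - F m u\<bar> \<le> L * dist x u" "\<bar>f x - f u\<bar> \<le> L * dist x u"
        using elim(1) f by auto
      moreover have "\<bar>F m x - f x\<bar> < r / 3" using elim(2) x by (auto simp: dist_real_def)
      ultimately show "dist (F m u) (f u) < r" unfolding dist_real_def by linarith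
    qed
  qed
qed

section \<open>Soft transforms for a Lipschitz cost on a compact space\<close>

locale compact_lipschitz_cost =
  fixes C :: "'a::metric_space \<Rightarrow> 'a \<Rightarrow> real" and L :: real
  assumes compact_space: "compact (UNIV :: 'a set)"
    and lipschitz: "L-lipschitz_on UNIV (\<lambda>(u, v). C u v)"
begin

lemma L_nonneg: "0 \<le> L"
  using lipschitz by (rule lipschitz_on_nonneg)

lemma cost_diff_le: "\<bar>C u v - C u' v'\<bar> \<le> L * dist (u, v) (u', v')"
  using lipschitz_onD[OF lipschitz, of "(u, v)" "(u', v')"] by (simp add: dist_real_def)

lemma cost_diff_fst_le: "\<bar>C u v - C u' v\<bar> \<le> L * dist u u'"
  using cost_diff_le[of u v u' v] by (simp add: dist_Pair_Pair)

lemma continuous_cost: "continuous_on UNIV (\<lambda>(u, v). C u v)"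
  using lipschitz by (rule lipschitz_on_continuous_on)

lemma continuous_cost_compose [continuous_intros]:
  assumes "continuous_on A p" "continuous_on A q"
  shows "continuous_on A (\<lambda>z. C (p z) (q z))"
  using continuous_on_compose2[OF continuous_cost continuous_on_Pair[OF assms]] by simp

lemma bounded_continuous:
  fixes h :: "'a \<Rightarrow> real"
  assumes "continuous_on UNIV h"
  shows "bounded (range h)"
  using compact_continuous_image[OF assms compact_space] by (rule compact_imp_bounded)

lemma integrable_continuous:
  fixes h :: "'a \<Rightarrow> real"
  assumes "prob_space \<mu>" "sets \<mu> = sets borel" "continuous_on UNIV h"
  shows "integrable \<mu> h"
proof -
  interpret prob_space \<mu> by fact
  obtain K where "\<And>v. norm (h v) \<le> K"
    using bounded_continuous[OF assms(3)] by (auto simp: bounded_iff)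
  moreover have "h \<in> borel_measurable \<mu>"
    using borel_measurable_continuous_onI[OF assms(3)] assms(2) by (simp cong: measurable_cong_sets)
  ultimately show ?thesis by (intro integrable_const_bound[of _ K]) auto
qed

lemma integrable_kernel:
  assumes "prob_space \<mu>" "sets \<mu> = sets borel" "continuous_on UNIV h"
  shows "integrable \<mu> (\<lambda>v. exp (h v - C u v))"
  by (intro integrable_continuous assms continuous_intros)

lemma integral_kernel_pos:
  assumes "prob_space \<mu>" "sets \<mu> = sets borel" "continuous_on UNIV h"
  shows "0 < (\<integral>v. exp (h v - C u v) \<partial>\<mu>)"
proof -
  interpret prob_space \<mu> by fact
  have "continuous_on UNIV (\<lambda>v. h v - C u v)"
    by (intro continuous_intros assms)
  then obtain b where b: "\<And>v. norm (h v - C u v) \<le> b"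
    using bounded_continuous by (auto simp: bounded_iff)
  have "exp (- b) \<le> exp (h v - C u v)" for v
    using b[of v] by simp
  then have "exp (- b) \<le> (\<integral>v. exp (h v - C u v) \<partial>\<mu>)"
    by (intro integral_ge_const integrable_kernel assms) auto
  then show ?thesis using exp_gt_zero[of "- b"] by linarith
qed

lemma exp_soft_transform:
  assumes "prob_space \<mu>" "sets \<mu> = sets borel" "continuous_on UNIV h"
  shows "exp (- soft_transform C \<mu> h u) = (\<integral>v. exp (h v - C u v) \<partial>\<mu>)"
  using integral_kernel_pos[OF assms] by (simp add: soft_transform_def)

text \<open>Moving \<open>u\<close> by a distance \<open>d\<close> changes the integrand by a factor of at most \<open>exp (L * d)\<close>,
  hence the logarithm of the integral by at most \<open>L * d\<close>; the potential does not influence the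
  Lipschitz constant.\<close>

lemma soft_transform_lipschitz:
  assumes "prob_space \<mu>" "sets \<mu> = sets borel" "continuous_on UNIV h"
  shows "\<bar>soft_transform C \<mu> h u - soft_transform C \<mu> h u'\<bar> \<le> L * dist u u'"
proof -
  have one: "soft_transform C \<mu> h u' - soft_transform C \<mu> h u \<le> L * dist u u'" for u u'
  proof -
    have "exp (- soft_transform C \<mu> h u) \<le> (\<integral>v. exp (L * dist u u') * exp (h v - C u' v) \<partial>\<mu>)"
      unfolding exp_soft_transform[OF assms]
    proof (intro integral_mono integrable_kernel integrable_mult_right assms)
      fix v
      show "exp (h v - C u v) \<le> exp (L * dist u u') * exp (h v - C u' v)"
        using cost_diff_fst_le[of u v u'] by (simp add: exp_add[symmetric])
    qed
    also have "\<dots> = exp (L * dist u u') * exp (- soft_transform C \<mu> h u')"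
      unfolding exp_soft_transform[OF assms] by (rule integral_mult_right_zero)
    also have "\<dots> = exp (L * dist u u' - soft_transform C \<mu> h u')"
      by (simp add: exp_add[symmetric])
    finally show ?thesis by simp
  qed
  show ?thesis using one[of u u'] one[of u' u] by (simp add: dist_commute abs_le_iff)
qed

lemma continuous_soft_transform:
  assumes "prob_space \<mu>" "sets \<mu> = sets borel" "continuous_on UNIV h"
  shows "continuous_on UNIV (soft_transform C \<mu> h)"
  by (rule lipschitz_on_continuous_on[of L], rule lipschitz_onI)
    (use soft_transform_lipschitz[OF assms] L_nonneg in \<open>auto simp: dist_real_def\<close>)

definition contraction_factor :: real where
  "contraction_factor = 1 - exp (- 2 * (L * diameter (UNIV :: 'a set)))"

lemma contraction_factor_bounds: "0 \<le> contraction_factor" "contraction_factor < 1"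
  using L_nonneg diameter_ge_0[OF compact_imp_bounded[OF compact_space]]
  by (auto simp: contraction_factor_def)

text \<open>
  This is the Birkhoff-Hopf contraction principle for positive kernels, in an elementary form.
  Put \<open>p = h - h' - m\<close> with \<open>m\<close> the infimum of \<open>h - h'\<close>. Up to the constant \<open>m\<close>, the difference of
  the two transforms at \<open>u\<close> is \<open>- ln (a u)\<close>, where \<open>a u\<close> is the average of \<open>exp p\<close> for the Gibbs
  weight \<open>exp (h' - C u)\<close>. The normalized weights at two points \<open>u\<close> and \<open>u'\<close> are comparable up to
  the factor \<open>\<epsilon> = exp (- 2 * L * diameter UNIV)\<close>: one exponential \<open>exp (- L * diameter UNIV)\<close> comes
  from the weights, the other from their total masses. As \<open>exp p - 1 \<ge> 0\<close>, this gives
  \<open>a u - 1 \<ge> \<epsilon> * (a u' - 1)\<close>, so \<open>ln (a u) \<ge> \<epsilon> * ln (a u')\<close> by concavity of the logarithm. Hence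
  \<open>ln (a u') - ln (a u) \<le> (1 - \<epsilon>) * ln (a u')\<close>, and \<open>ln (a u')\<close> is at most the oscillation of \<open>p\<close>.
\<close>

lemma var_norm_soft_transform_diff_le:
  assumes \<mu>: "prob_space \<mu>" "sets \<mu> = sets borel"
    and h: "continuous_on UNIV h" and h': "continuous_on UNIV h'"
  shows "var_norm (\<lambda>u. soft_transform C \<mu> h u - soft_transform C \<mu> h' u)
    \<le> contraction_factor * var_norm (\<lambda>u. h u - h' u)"
proof (rule var_norm_le)
  fix u u'
  define A where "A = L * diameter (UNIV :: 'a set)"
  define \<epsilon> where "\<epsilon> = exp (- 2 * A)"
  define d where "d v = h v - h' v" for v
  define m where "m = Inf (range d)"
  define D where "D = var_norm d"
  define q where "q x v = exp (h' v - C x v)" for x v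
  define Z where "Z x = (\<integral>v. q x v \<partial>\<mu>)" for x
  define a where "a x = (\<integral>v. exp (d v - m) * q x v \<partial>\<mu>) / Z x" for x
  have A: "\<bar>C x v - C x' v\<bar> \<le> A" for x x' v
  proof -
    have "L * dist x x' \<le> A"
      unfolding A_def using compact_space L_nonneg
      by (intro mult_left_mono diameter_bounded_bound compact_imp_bounded) auto
    then show ?thesis using cost_diff_fst_le[of x v x'] by linarith
  qed
  have A0: "0 \<le> A" using A[of u u u] by simp
  have \<epsilon>: "0 < \<epsilon>" "\<epsilon> \<le> 1" using A0 by (auto simp: \<epsilon>_def)
  have d: "continuous_on UNIV d" unfolding d_def by (intro continuous_intros h h')
  have m_le: "m \<le> d v" for v
    unfolding m_def using bounded_continuous[OF d]
    by (intro cInf_lower) (auto intro: bounded_imp_bdd_below)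
  have d_le: "d v \<le> m + D" for v
  proof -
    have "d v \<le> Sup (range d)"
      using bounded_continuous[OF d] by (intro cSup_upper) (auto intro: bounded_imp_bdd_above)
    then show ?thesis by (simp add: D_def var_norm_def m_def)
  qed
  have cq: "continuous_on UNIV (q x)" for x
    unfolding q_def by (intro continuous_intros h')
  have int_q: "integrable \<mu> (q x)" for x
    by (intro integrable_continuous \<mu> cq)
  have int_pq: "integrable \<mu> (\<lambda>v. exp (d v - m) * q x v)" for x
    by (intro integrable_continuous \<mu> continuous_intros d cq)
  have Z: "0 < Z x" for x
    unfolding Z_def q_def by (intro integral_kernel_pos \<mu> h')
  have Z_le: "Z x \<le> exp A * Z x'" for x x'
  proof -
    have "q x v \<le> exp A * q x' v" for v
      using A[of x v x'] by (simp add: q_def exp_add[symmetric])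
    then have "Z x \<le> (\<integral>v. exp A * q x' v \<partial>\<mu>)"
      unfolding Z_def by (intro integral_mono integrable_mult_right int_q)
    then show ?thesis by (simp add: Z_def)
  qed
  have a_minus_1: "a x - 1 = (\<integral>v. (exp (d v - m) - 1) * q x v \<partial>\<mu>) / Z x" for x
  proof -
    have "(\<integral>v. (exp (d v - m) - 1) * q x v \<partial>\<mu>) = (\<integral>v. exp (d v - m) * q x v \<partial>\<mu>) - Z x"
      unfolding Z_def by (simp add: left_diff_distrib Bochner_Integration.integral_diff[OF int_pq int_q])
    then show ?thesis using Z[of x] by (simp add: a_def diff_divide_distrib)
  qed
  have a_ge: "1 \<le> a x" for x
  proof -
    have "0 \<le> (\<integral>v. (exp (d v - m) - 1) * q x v \<partial>\<mu>)"
      using m_le by (intro Bochner_Integration.integral_nonneg) (auto simp: q_def)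
    then have "0 \<le> a x - 1"
      unfolding a_minus_1 using Z[of x] by (intro divide_nonneg_pos)
    then show ?thesis by simp
  qed
  have a_le: "a x \<le> exp D" for x
  proof -
    have "(\<integral>v. exp (d v - m) * q x v \<partial>\<mu>) \<le> (\<integral>v. exp D * q x v \<partial>\<mu>)"
    proof (intro integral_mono int_pq integrable_mult_right int_q mult_right_mono)
      show "exp (d v - m) \<le> exp D" for v using d_le[of v] by simp
      show "0 \<le> q x v" for v by (simp add: q_def)
    qed
    then show ?thesis using Z[of x] by (simp add: a_def Z_def[symmetric] pos_divide_le_eq)
  qed
  have transform: "soft_transform C \<mu> h x - soft_transform C \<mu> h' x = - ln (a x) - m" for x
  proof -
    have "(\<integral>v. exp (h v - C x v) \<partial>\<mu>) = (\<integral>v. exp m * (exp (d v - m) * q x v) \<partial>\<mu>)"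
      by (intro Bochner_Integration.integral_cong) (auto simp: d_def q_def exp_add[symmetric])
    also have "\<dots> = exp m * (a x * Z x)"
      using Z[of x] by (simp add: a_def)
    finally have "soft_transform C \<mu> h x = - (m + (ln (a x) + ln (Z x)))"
      unfolding soft_transform_def using a_ge[of x] Z[of x] by (simp add: ln_mult_pos)
    moreover have "soft_transform C \<mu> h' x = - ln (Z x)"
      by (simp add: soft_transform_def Z_def q_def)
    ultimately show ?thesis by simp
  qed
  have comparison: "\<epsilon> * (a u' - 1) \<le> a u - 1"
  proof -
    define P where "P x = (\<integral>v. (exp (d v - m) - 1) * q x v \<partial>\<mu>)" for x
    have int_P: "integrable \<mu> (\<lambda>v. (exp (d v - m) - 1) * q x v)" for x
      by (intro integrable_continuous \<mu> continuous_intros d cq)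
    have P0: "0 \<le> P x" for x
      unfolding P_def using m_le by (intro Bochner_Integration.integral_nonneg) (auto simp: q_def)
    have "P u' \<le> (\<integral>v. exp A * ((exp (d v - m) - 1) * q u v) \<partial>\<mu>)"
      unfolding P_def
    proof (intro integral_mono int_P integrable_mult_right)
      fix v
      have "q u' v \<le> exp A * q u v"
        using A[of u' v u] by (simp add: q_def exp_add[symmetric])
      then have "(exp (d v - m) - 1) * q u' v \<le> (exp (d v - m) - 1) * (exp A * q u v)"
        using m_le[of v] by (intro mult_left_mono) auto
      then show "(exp (d v - m) - 1) * q u' v \<le> exp A * ((exp (d v - m) - 1) * q u v)"
        by (simp add: mult_ac)
    qed
    then have P: "P u' \<le> exp A * P u" by (simp add: P_def)
    have "P u' * Z u \<le> (exp A * P u) * (exp A * Z u')"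
      by (rule mult_mono[OF P Z_le]) (use P0 Z[of u] in auto)
    also have "\<dots> = P u * Z u' / \<epsilon>"
      by (simp add: \<epsilon>_def exp_minus field_simps exp_add[symmetric])
    finally have "\<epsilon> * (P u' / Z u') \<le> P u / Z u"
      using \<epsilon> Z[of u] Z[of u'] by (simp add: field_simps)
    then show ?thesis by (simp add: a_minus_1 P_def)
  qed
  have "\<epsilon> * ln (a u') \<le> ln (1 + \<epsilon> * (a u' - 1))"
  proof -
    have "(1 - \<epsilon>) * ln 1 + \<epsilon> * ln (a u') \<le> ln ((1 - \<epsilon>) *\<^sub>R 1 + \<epsilon> *\<^sub>R a u')"
      using concave_onD[OF ln_concave, of \<epsilon> 1 "a u'"] \<epsilon> a_ge[of u'] by simp
    then show ?thesis by (simp add: algebra_simps)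
  qed
  also have "\<dots> \<le> ln (a u)"
    using comparison a_ge[of u'] \<epsilon> a_ge[of u]
    by (intro ln_mono) (auto intro: add_pos_nonneg)
  finally have "ln (a u') - ln (a u) \<le> (1 - \<epsilon>) * ln (a u')"
    by (simp add: algebra_simps)
  also have "\<dots> \<le> (1 - \<epsilon>) * D"
  proof (rule mult_left_mono)
    have "ln (a u') \<le> ln (exp D)"
      using a_le[of u'] a_ge[of u'] by (subst ln_le_cancel_iff) auto
    then show "ln (a u') \<le> D" by simp
  qed (use \<epsilon> in simp)
  finally show "soft_transform C \<mu> h u - soft_transform C \<mu> h' u
      - (soft_transform C \<mu> h u' - soft_transform C \<mu> h' u')
    \<le> contraction_factor * var_norm (\<lambda>u. h u - h' u)"
    unfolding transform
    by (simp add: contraction_factor_def \<epsilon>_def A_def D_def d_def[abs_def])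
qed

text \<open>At a fixed point \<open>u\<close> this is the law of large numbers for the bounded variables
  \<open>exp (h (z i) - C u (z i))\<close>. It holds simultaneously at the points of countably many finite nets,
  and all the transforms share the Lipschitz constant \<open>L\<close>.\<close>

lemma AE_uniform_limit_soft_transform_empirical:
  fixes z :: "nat \<Rightarrow> 'w \<Rightarrow> 'a"
  assumes M: "prob_space M" and indep: "prob_space.indep_vars M (\<lambda>_. borel) z UNIV"
    and distr: "\<And>i. distr M borel (z i) = \<mu>"
    and h: "continuous_on UNIV h"
  shows "AE \<omega> in M. uniform_limit UNIV
    (\<lambda>m. soft_transform C (empirical_measure m (\<lambda>i. z i \<omega>)) h) (soft_transform C \<mu> h) sequentially"
proof -
  interpret prob_space M by (rule M)
  have z [measurable]: "random_variable borel (z i)" for i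
    using indep by (auto simp: indep_vars_def2)
  have \<mu>: "prob_space \<mu>" "sets \<mu> = sets borel"
    unfolding distr[of 0, symmetric] by (auto intro: prob_space_distr)
  have pointwise: "AE \<omega> in M. (\<lambda>m. soft_transform C (empirical_measure m (\<lambda>i. z i \<omega>)) h u)
      \<longlonglongrightarrow> soft_transform C \<mu> h u" for u
  proof -
    define \<phi> where "\<phi> v = exp (h v - C u v)" for v
    have c: "continuous_on UNIV \<phi>"
      unfolding \<phi>_def by (intro continuous_intros h)
    have meas [measurable]: "\<phi> \<in> borel_measurable borel"
      by (rule borel_measurable_continuous_onI[OF c])
    obtain K where K: "\<And>v. \<bar>\<phi> v\<bar> \<le> K"
      using bounded_continuous[OF c] by (auto simp: bounded_iff)
    have law: "distr M borel (\<lambda>\<omega>. \<phi> (z i \<omega>)) = distr \<mu> borel \<phi>" for i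
      unfolding distr[of i, symmetric] by (subst distr_distr) (auto simp: comp_def)
    have "AE \<omega> in M. (\<lambda>m. (\<Sum>i<m. \<phi> (z i \<omega>)) / real m) \<longlonglongrightarrow> expectation (\<lambda>\<omega>. \<phi> (z 0 \<omega>))"
      using K by (intro strong_law_of_large_numbers_bounded[where K = K]
          indep_vars_compose2[OF indep]) (auto simp: law)
    also have "expectation (\<lambda>\<omega>. \<phi> (z 0 \<omega>)) = (\<integral>v. \<phi> v \<partial>\<mu>)"
      unfolding distr[of 0, symmetric] by (subst integral_distr) auto
    finally show ?thesis
    proof eventually_elim
      case (elim \<omega>)
      have "0 < (\<integral>v. \<phi> v \<partial>\<mu>)"
        unfolding \<phi>_def by (rule integral_kernel_pos[OF \<mu> h])
      then have "(\<lambda>m. - ln ((\<Sum>i<m. \<phi> (z i \<omega>)) / real m)) \<longlonglongrightarrow> - ln (\<integral>v. \<phi> v \<partial>\<mu>)"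
        by (intro tendsto_intros elim) auto
      then show ?case
        using integral_empirical_measure[OF meas] by (simp add: soft_transform_def \<phi>_def)
    qed
  qed
  obtain D where D: "countable D"
    and nets: "\<And>e. e > 0 \<Longrightarrow> \<exists>K\<subseteq>D. finite K \<and> (UNIV :: 'a set) \<subseteq> (\<Union>x\<in>K. ball x e)"
    using compact_obtain_countable_nets[OF compact_space] by blast
  have "AE \<omega> in M. \<forall>u\<in>D. (\<lambda>m. soft_transform C (empirical_measure m (\<lambda>i. z i \<omega>)) h u)
      \<longlonglongrightarrow> soft_transform C \<mu> h u"
    using D pointwise by (subst AE_ball_countable) auto
  then show ?thesis
  proof eventually_elim
    case (elim \<omega>)
    \<comment> \<open>the empirical measure of no samples is the zero measure, so the bound starts at \<open>m = 1\<close>\<close>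
    have "\<forall>\<^sub>F m in sequentially. \<forall>u v. \<bar>soft_transform C (empirical_measure m (\<lambda>i. z i \<omega>)) h u
        - soft_transform C (empirical_measure m (\<lambda>i. z i \<omega>)) h v\<bar> \<le> L * dist u v"
      using eventually_gt_at_top[of 0]
      by eventually_elim
        (intro allI soft_transform_lipschitz prob_space_empirical_measure sets_empirical_measure h)
    then show ?case
      using elim
      by (intro equi_lipschitz_uniform_limit[OF L_nonneg _ _ nets] soft_transform_lipschitz \<mu> h) auto
  qed
qed

lemma AE_var_norm_soft_transform_empirical_tendsto_0:
  fixes z :: "nat \<Rightarrow> 'w \<Rightarrow> 'a"
  assumes "prob_space M" "prob_space.indep_vars M (\<lambda>_. borel) z UNIV"
    and distr: "\<And>i. distr M borel (z i) = \<mu>"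
    and h: "continuous_on UNIV h"
  shows "AE \<omega> in M. (\<lambda>m. var_norm (\<lambda>u. soft_transform C (empirical_measure m (\<lambda>i. z i \<omega>)) h u
    - soft_transform C \<mu> h u)) \<longlonglongrightarrow> 0"
  using AE_uniform_limit_soft_transform_empirical[OF assms]
proof eventually_elim
  case (elim \<omega>)
  interpret prob_space M by fact
  have "random_variable borel (z 0)" using assms(2) by (auto simp: indep_vars_def2)
  then have \<mu>: "prob_space \<mu>" "sets \<mu> = sets borel"
    unfolding distr[of 0, symmetric] by (auto intro: prob_space_distr)
  have "\<forall>\<^sub>F m in sequentially. bounded (range (\<lambda>u. soft_transform C (empirical_measure m (\<lambda>i. z i \<omega>)) h u
      - soft_transform C \<mu> h u))"
    using eventually_gt_at_top[of 0]
    by eventually_elim (intro bounded_continuous continuous_on_diff continuous_soft_transform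
        prob_space_empirical_measure sets_empirical_measure \<mu> h)
  with elim show ?case by (rule uniform_limit_imp_var_norm_tendsto_0)
qed

section \<open>The fully-corrective online Sinkhorn iterates\<close>

lemma fully_corrective_sinkhorn_continuous:
  assumes alg: "fully_corrective_sinkhorn C n x y f g"
    and n: "\<And>t. t \<ge> 1 \<Longrightarrow> n t > 0" and "t \<ge> 1"
  shows "continuous_on UNIV (f t) \<and> continuous_on UNIV (g t)"
  using \<open>t \<ge> 1\<close>
proof (induction t rule: dec_induct)
  case base
  \<comment> \<open>the initial potentials are minus logarithms of positive continuous functions\<close>
  have f: "f 1 = (\<lambda>u. - ln (\<Sum>i<n 1. exp (- C u (y i))))"
  proof
    fix u
    have "exp (- f 1 u) = (\<Sum>i<n 1. exp (- C u (y i)))"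
      using alg by (simp add: fully_corrective_sinkhorn_def)
    from arg_cong[OF this, of ln] show "f 1 u = - ln (\<Sum>i<n 1. exp (- C u (y i)))" by simp
  qed
  have g: "g 1 = (\<lambda>v. - ln (\<Sum>i<n 1. exp (- C (x i) v)))"
  proof
    fix v
    have "exp (- g 1 v) = (\<Sum>i<n 1. exp (- C (x i) v))"
      using alg by (simp add: fully_corrective_sinkhorn_def)
    from arg_cong[OF this, of ln] show "g 1 v = - ln (\<Sum>i<n 1. exp (- C (x i) v))" by simp
  qed
  have pos: "0 < (\<Sum>i<n 1. exp (c i :: real))" for c
    using n[of 1] by (intro sum_pos) (auto simp: lessThan_empty_iff)
  show ?case
    unfolding f g using pos by (auto intro!: continuous_intros simp: less_imp_neq[symmetric])
next
  case (step t)
  have "n (Suc t) > 0" by (rule n) simp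
  then show ?case
    using alg step
    by (auto simp: fully_corrective_sinkhorn_def
        intro!: continuous_soft_transform prob_space_empirical_measure sets_empirical_measure)
qed

text \<open>The intermediate point is the transform of the limit potential \<open>k\<close> with respect to the same
  measure as the one that produces the iterate; the first part of the path is contracted, the second
  measures only how well that measure represents the true one.\<close>

lemma var_norm_soft_transform_minus_le:
  assumes \<mu>: "prob_space \<mu>" "sets \<mu> = sets borel"
    and h: "continuous_on UNIV h" and k: "continuous_on UNIV k" and l: "continuous_on UNIV l"
  shows "var_norm (\<lambda>u. soft_transform C \<mu> h u - l u)
    \<le> contraction_factor * var_norm (\<lambda>u. h u - k u) + var_norm (\<lambda>u. soft_transform C \<mu> k u - l u)"
proof -
  let ?T = "soft_transform C \<mu>"
  have "var_norm (\<lambda>u. (?T h u - ?T k u) + (?T k u - l u))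
      \<le> var_norm (\<lambda>u. ?T h u - ?T k u) + var_norm (\<lambda>u. ?T k u - l u)"
    by (intro var_norm_add_le bounded_continuous continuous_on_diff continuous_soft_transform \<mu> h k l)
  with var_norm_soft_transform_diff_le[OF \<mu> h k] show ?thesis by simp
qed

lemma fully_corrective_sinkhorn_tendsto:
  assumes alg: "fully_corrective_sinkhorn C n x y f g"
    and n: "\<And>t. t \<ge> 1 \<Longrightarrow> n t > 0"
    and fstar: "continuous_on UNIV fstar" and gstar: "continuous_on UNIV gstar"
    and f_lim: "(\<lambda>t. var_norm (\<lambda>u. soft_transform C (empirical_measure (n (t + 1)) y) gstar u - fstar u))
      \<longlonglongrightarrow> 0"
    and g_lim: "(\<lambda>t. var_norm (\<lambda>u. soft_transform C (empirical_measure (n (t + 1)) x) fstar u - gstar u))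
      \<longlonglongrightarrow> 0"
  shows "(\<lambda>t. var_norm (\<lambda>u. f t u - fstar u) + var_norm (\<lambda>u. g t u - gstar u)) \<longlonglongrightarrow> 0"
    (is "?e \<longlonglongrightarrow> 0")
proof (rule contraction_with_vanishing_error_tendsto_0[OF contraction_factor_bounds])
  have cont: "continuous_on UNIV (f t) \<and> continuous_on UNIV (g t)" if "t \<ge> 1" for t
    using n that by (intro fully_corrective_sinkhorn_continuous[OF alg])
  show "0 \<le> ?e t" if "t \<ge> 1" for t
    using cont[OF that] fstar gstar
    by (intro add_nonneg_nonneg var_norm_nonneg bounded_continuous continuous_on_diff) auto
  show "(\<lambda>t. var_norm (\<lambda>u. soft_transform C (empirical_measure (n (t + 1)) y) gstar u - fstar u)
      + var_norm (\<lambda>u. soft_transform C (empirical_measure (n (t + 1)) x) fstar u - gstar u)) \<longlonglongrightarrow> 0"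
    (is "?\<delta> \<longlonglongrightarrow> 0")
    using tendsto_add[OF f_lim g_lim] by simp
  fix t :: nat assume t: "t \<ge> 1"
  have f: "f (t + 1) = soft_transform C (empirical_measure (n (t + 1)) y) (g t)"
    and g: "g (t + 1) = soft_transform C (empirical_measure (n (t + 1)) x) (f t)"
    using alg t by (auto simp: fully_corrective_sinkhorn_def)
  have "n (t + 1) > 0" by (rule n) simp
  note emp = prob_space_empirical_measure[OF this] sets_empirical_measure
  have "var_norm (\<lambda>u. f (t + 1) u - fstar u) \<le> contraction_factor * var_norm (\<lambda>u. g t u - gstar u)
      + var_norm (\<lambda>u. soft_transform C (empirical_measure (n (t + 1)) y) gstar u - fstar u)"
    unfolding f using cont[OF t] fstar gstar by (intro var_norm_soft_transform_minus_le emp) auto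
  moreover have "var_norm (\<lambda>u. g (t + 1) u - gstar u) \<le> contraction_factor * var_norm (\<lambda>u. f t u - fstar u)
      + var_norm (\<lambda>u. soft_transform C (empirical_measure (n (t + 1)) x) fstar u - gstar u)"
    unfolding g using cont[OF t] fstar gstar by (intro var_norm_soft_transform_minus_le emp) auto
  ultimately show "?e (t + 1) \<le> contraction_factor * ?e t + ?\<delta> t"
    by (simp add: distrib_left)
qed

end

section \<open>Almost sure convergence\<close>

theorem proposition6:
  fixes C :: "'a::metric_space \<Rightarrow> 'a \<Rightarrow> real" and L B :: real
    and \<alpha> \<beta> :: "'a measure" and fstar gstar :: "'a \<Rightarrow> real"
    and M :: "'w measure" and x y :: "nat \<Rightarrow> 'w \<Rightarrow> 'a"
    and batch n :: "nat \<Rightarrow> nat" and w \<eta> :: "nat \<Rightarrow> real"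
    and fhat ghat :: "nat \<Rightarrow> 'w \<Rightarrow> 'a \<Rightarrow> real"
  assumes "compact (UNIV :: 'a set)"
    and "\<And>u v. C u v = C v u"
    and "L-lipschitz_on UNIV (\<lambda>(u, v). C u v)"
    and "prob_space \<alpha>" "sets \<alpha> = sets borel"
    and "prob_space \<beta>" "sets \<beta> = sets borel"
    and "optimal_potentials C \<alpha> \<beta> fstar gstar"
    and "prob_space M"
    and "prob_space.indep_vars M (\<lambda>_. borel) (case_sum x y) UNIV"
    and "\<And>i. distr M borel (x i) = \<alpha>"
    and "\<And>i. distr M borel (y i) = \<beta>"
    and "\<And>t. batch t \<ge> 1"
    and "n 0 = 0" "\<And>t. n (t + 1) = n t + batch t"
    and "B > 0"
    and "\<And>t. t > 0 \<Longrightarrow> w t > 0"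
    and "\<And>t. t > 0 \<Longrightarrow> 0 \<le> \<eta> t \<and> \<eta> t \<le> 1"
    and "\<And>t. t > 0 \<Longrightarrow> real (n t) = B / (w t)\<^sup>2"
    and "summable (\<lambda>t. w t * \<eta> t)"
    and "filterlim (\<lambda>N. \<Sum>t=1..N. \<eta> t) at_top sequentially"
    and "\<And>\<omega>. \<omega> \<in> space M \<Longrightarrow>
      fully_corrective_sinkhorn C n (\<lambda>i. x i \<omega>) (\<lambda>i. y i \<omega>) (\<lambda>t. fhat t \<omega>) (\<lambda>t. ghat t \<omega>)"
  shows "AE \<omega> in M. (\<lambda>t. var_norm (\<lambda>u. fhat t \<omega> u - fstar u) + var_norm (\<lambda>u. ghat t \<omega> u - gstar u))
           \<longlonglongrightarrow> 0"
proof -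
  interpret compact_lipschitz_cost C L
    using assms(1,3) by unfold_locales
  interpret prob_space M by fact
  have fstar: "continuous_on UNIV fstar" "fstar = soft_transform C \<beta> gstar"
    and gstar: "continuous_on UNIV gstar" "gstar = soft_transform C \<alpha> fstar"
    using assms(8) unfolding optimal_potentials_def by - (elim conjE, assumption)+
  have n_ge: "t \<le> n t" for t
  proof (induction t)
    case (Suc t)
    then show ?case using assms(15)[of t] assms(13)[of t] by simp
  qed simp
  have n_pos: "n t > 0" if "t \<ge> 1" for t
    using n_ge[of t] that by linarith
  have n_lim: "filterlim (\<lambda>t. n (t + 1)) at_top sequentially"
  proof (rule filterlim_at_top_mono[OF filterlim_ident])
    show "\<forall>\<^sub>F t in sequentially. t \<le> n (t + 1)"
      using Suc_leD[OF n_ge] by simp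
  qed
  have x: "indep_vars (\<lambda>_. borel) x UNIV"
    using indep_vars_reindex[OF assms(10) inj_Inl] by simp
  have y: "indep_vars (\<lambda>_. borel) y UNIV"
    using indep_vars_reindex[OF assms(10) inj_Inr] by simp
  have "AE \<omega> in M. (\<lambda>m. var_norm (\<lambda>u. soft_transform C (empirical_measure m (\<lambda>i. y i \<omega>)) gstar u
      - fstar u)) \<longlonglongrightarrow> 0"
    using AE_var_norm_soft_transform_empirical_tendsto_0[OF assms(9) y assms(12) gstar(1)]
    unfolding fstar(2)[symmetric] .
  moreover have "AE \<omega> in M. (\<lambda>m. var_norm (\<lambda>u. soft_transform C (empirical_measure m (\<lambda>i. x i \<omega>)) fstar u
      - gstar u)) \<longlonglongrightarrow> 0"
    using AE_var_norm_soft_transform_empirical_tendsto_0[OF assms(9) x assms(11) fstar(1)]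
    unfolding gstar(2)[symmetric] .
  ultimately show ?thesis
    using AE_space
  proof eventually_elim
    case (elim \<omega>)
    show ?case
      by (rule fully_corrective_sinkhorn_tendsto[OF assms(22)[OF elim(3)] _ fstar(1) gstar(1)
            filterlim_compose[OF elim(1) n_lim] filterlim_compose[OF elim(2) n_lim]])
        (rule n_pos)
  qed
qed

end
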